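(* Let $p$ be a prime, let $k\ge1$ be an integer, and let $1\le\alpha_1\le\alpha_2\le\dots\le\alpha_k$ be integers. For every integer $\alpha$ with $1\le\alpha\le\alpha_k$, the number of cyclic subgroups of order $p^\alpha$ in the finite abelian $p$-group $\mathbb{Z}_{p^{\alpha_1}}\times\mathbb{Z}_{p^{\alpha_2}}\times\cdots\times\mathbb{Z}_{p^{\alpha_k}}$ is $$g^k_p(\alpha)=\frac{p^\alpha h^{k-1}_p(\alpha)-p^{\alpha-1}h^{k-1}_p(\alpha-1)}{p^\alpha-p^{\alpha-1}},$$ where $$h^{k-1}_p(\alpha)=\begin{cases}p^{(k-1)\alpha}, & \text{if } 0\le\alpha\le\alpha_1,\\ p^{(k-2)\alpha+\alpha_1}, & \text{if } \alpha_1\le\alpha\le\alpha_2,\\ \ \vdots & \\ p^{\alpha_1+\alpha_2+\dots+\alpha_{k-1}}, & \text{if } \alpha_{k-1}\le\alpha.\end{cases}$$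
   Context: $\mathbb{Z}_m$ denotes the cyclic group of order $m$. Explicitly, the case definition of $h^{k-1}_p$ reads, with the convention $\alpha_0=0$: for $0\le j\le k-2$ and $\alpha_j\le\alpha\le\alpha_{j+1}$ one has $h^{k-1}_p(\alpha)=p^{(k-1-j)\alpha+\alpha_1+\dots+\alpha_j}$, and for $\alpha\ge\alpha_{k-1}$ one has $h^{k-1}_p(\alpha)=p^{\alpha_1+\dots+\alpha_{k-1}}$ (so $h^0_p(\alpha)=1$ for all $\alpha\ge0$ when $k=1$). *)

theory Defs
  imports
    Complex_Main
    "HOL-Computational_Algebra.Primes"
    "HOL-Algebra.Product_Groups"
begin

definition cyclic_subgroups :: "('a, 'b) monoid_scheme \<Rightarrow> nat \<Rightarrow> 'a set set" where
  "cyclic_subgroups G n =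
     {H. subgroup H G \<and> cyclic_group (G\<lparr>carrier := H\<rparr>) \<and> card H = n}"

definition abelian_p_group :: "nat \<Rightarrow> nat \<Rightarrow> (nat \<Rightarrow> nat) \<Rightarrow> (nat \<Rightarrow> int) monoid" where
  "abelian_p_group p k a = product_group {1..k} (\<lambda>i. integer_mod_group (p ^ a i))"

(* h_case m a x is the number j of the first applicable case in the definition of h^m_p(x) by
   cases: case j < m applies for a_j <= x <= a_{j+1} (where a_0 = 0, so the value of the function
   a at 0 is irrelevant), and case m applies for a_m <= x. Neighbouring cases overlap at the a_j;
   lemma h_fun_eq below shows that h_fun has the prescribed value in every case that applies. *)
definition h_case :: "nat \<Rightarrow> (nat \<Rightarrow> nat) \<Rightarrow> nat \<Rightarrow> nat" where
  "h_case m a x = (LEAST j. j < m \<longrightarrow> x \<le> a (Suc j))"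

definition h_fun :: "nat \<Rightarrow> nat \<Rightarrow> (nat \<Rightarrow> nat) \<Rightarrow> nat \<Rightarrow> nat" where
  "h_fun p m a x = (let j = h_case m a x in p ^ ((m - j) * x + (\<Sum>i=1..j. a i)))"

lemma h_fun_eq:
  assumes mono: "mono_on {1..m} a"
    and "j \<le> m" and lower: "0 < j \<Longrightarrow> a j \<le> x" and upper: "j < m \<Longrightarrow> x \<le> a (Suc j)"
  shows "h_fun p m a x = p ^ ((m - j) * x + (\<Sum>i=1..j. a i))"
proof -
  define l where "l = h_case m a x"
  have "l \<le> j"
    unfolding l_def h_case_def by (rule Least_le) (use upper in blast)
  have l: "l < m \<longrightarrow> x \<le> a (Suc l)"
    unfolding l_def h_case_def by (rule LeastI[of _ m]) simp
  have eq: "a i = x" if "i \<in> {Suc l..j}" for i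
  proof -
    have "a (Suc l) \<le> a i" "a i \<le> a j"
      using that \<open>j \<le> m\<close> by (auto intro!: mono_onD[OF mono])
    with l lower that \<open>j \<le> m\<close> show ?thesis by auto
  qed
  have "{1..j} = {1..l} \<union> {Suc l..j}" using \<open>l \<le> j\<close> by auto
  then have "(\<Sum>i=1..j. a i) = (\<Sum>i=1..l. a i) + (\<Sum>i=Suc l..j. a i)"
    by (simp add: sum.union_disjoint)
  also have "(\<Sum>i=Suc l..j. a i) = (j - l) * x"
    using eq by simp
  finally have "(m - j) * x + (\<Sum>i=1..j. a i) = ((m - j) + (j - l)) * x + (\<Sum>i=1..l. a i)"
    by (simp add: algebra_simps)
  also have "(m - j) + (j - l) = m - l"
    using \<open>l \<le> j\<close> \<open>j \<le> m\<close> by simp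
  finally show ?thesis by (simp add: h_fun_def Let_def flip: l_def)
qed

definition g_fun :: "nat \<Rightarrow> nat \<Rightarrow> (nat \<Rightarrow> nat) \<Rightarrow> nat \<Rightarrow> real" where
  "g_fun p k a x =
     (real p ^ x * real (h_fun p (k - 1) a x) - real p ^ (x - 1) * real (h_fun p (k - 1) a (x - 1)))
       / (real p ^ x - real p ^ (x - 1))"

end

theory Submission
  imports Defs "HOL-Algebra.Multiplicative_Group" "HOL-Number_Theory.Totient"
begin

text \<open>
  The proof counts elements instead of subgroups. A cyclic subgroup of order \<open>n\<close> has exactly
  \<open>totient n\<close> generators, and every element of order \<open>n\<close> generates exactly one such subgroup, so
  a finite group has \<open>totient n\<close> times as many elements of order \<open>n\<close> as cyclic subgroups of
  order \<open>n\<close> (lemma \<open>card_ord_eq_totient_mult_cyclic_subgroups\<close>).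

  An element has order \<open>p ^ x\<close>, for \<open>x \<ge> 1\<close>, iff it is killed by \<open>p ^ x\<close> but not by
  \<open>p ^ (x - 1)\<close>, so it remains to count the solutions of \<open>g ^ (p ^ x) = 1\<close>. They can be
  counted in each factor separately, and the cyclic group of order \<open>p ^ a i\<close> has
  \<open>gcd (p ^ x) (p ^ a i) = p ^ min x (a i)\<close> of them. Hence the direct product has
  \<open>p ^ (\<Sum>i=1..k. min x (a i))\<close> solutions (lemma \<open>card_torsion_abelian_p_group\<close>). For
  \<open>x \<le> a k\<close> the last factor contributes \<open>p ^ x\<close>, and the others contribute
  \<open>h_fun p (k - 1) a x\<close> (lemma \<open>h_fun_eq_sum_min\<close>). Subtracting the values at \<open>x\<close> and \<open>x - 1\<close>
  gives the numerator of \<open>g_fun\<close>, and \<open>totient (p ^ x) = p ^ x - p ^ (x - 1)\<close> is its denominator.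
\<close>

section \<open>Cyclic subgroups and elements of a given order\<close>

lemma (in group) cyclic_subgroupsE:
  assumes "H \<in> cyclic_subgroups G n" "n > 0"
  obtains x where "x \<in> carrier G" "H = generate G {x}" "ord x = n"
proof -
  have H: "subgroup H G" "cyclic_group (G\<lparr>carrier := H\<rparr>)" "card H = n"
    using assms by (auto simp: cyclic_subgroups_def)
  interpret H: group "G\<lparr>carrier := H\<rparr>"
    using H(1) by (rule subgroup_imp_group)
  obtain x where x: "x \<in> H" "H = range (\<lambda>k::int. x [^]\<^bsub>G\<lparr>carrier := H\<rparr>\<^esub> k)"
    using H(2) unfolding H.cyclic_group by auto
  have xG: "x \<in> carrier G" using x(1) subgroup.subset[OF H(1)] by blast
  have "H = range (\<lambda>k::int. x [^] k)"
    using x int_pow_consistent[OF H(1) x(1)] by simp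
  then have "H = generate G {x}"
    using generate_pow[OF xG] by auto
  moreover have "ord x = n"
    using generate_pow_card[OF xG] calculation H(3) by simp
  ultimately show thesis using that xG by blast
qed

lemma (in group) generate_in_cyclic_subgroups:
  assumes "x \<in> carrier G"
  shows "generate G {x} \<in> cyclic_subgroups G (ord x)"
proof -
  have "subgroup_generated G {x} = G\<lparr>carrier := generate G {x}\<rparr>"
    using assms by (simp add: subgroup_generated_def)
  then have "cyclic_group (G\<lparr>carrier := generate G {x}\<rparr>)"
    using cyclic_group_generated[of x] by simp
  then show ?thesis
    using assms generate_is_subgroup[of "{x}"] generate_pow_card[of x]
    by (simp add: cyclic_subgroups_def)
qed

lemma (in group) cyclic_subgroup_eq_generate:
  assumes "H \<in> cyclic_subgroups G n" "n > 0" "x \<in> H" "ord x = n"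
  shows "H = generate G {x}"
proof -
  have H: "subgroup H G" "card H = n"
    using assms by (auto simp: cyclic_subgroups_def)
  have "x \<in> carrier G" using assms(3) subgroup.subset[OF H(1)] by blast
  then have "card (generate G {x}) = card H"
    using generate_pow_card[of x] assms(4) H(2) by simp
  moreover have "generate G {x} \<subseteq> H"
    using generate_subgroup_incl[of "{x}" H] H(1) assms(3) by simp
  moreover have "finite H" using H(2) \<open>n > 0\<close> card_ge_0_finite by blast
  ultimately show ?thesis by (metis card_subset_eq)
qed

lemma (in group) card_generators_cyclic_subgroup:
  assumes "H \<in> cyclic_subgroups G n" "n > 0"
  shows "card {y \<in> H. ord y = n} = totient n"
proof -
  obtain x where x: "x \<in> carrier G" "H = generate G {x}" "ord x = n"
    using assms by (rule cyclic_subgroupsE)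
  have inj: "inj_on (\<lambda>k. x [^] k) {1..n}"
    using ord_inj'[OF x(1)] x(3) by simp
  have sub: "(\<lambda>k. x [^] k) ` {1..n} \<subseteq> H"
    using x generate_pow_nat[OF x(1)] \<open>n > 0\<close> by auto
  have card_H: "card H = n" using generate_pow_card[OF x(1)] x by simp
  \<comment> \<open>The \<open>n\<close> powers are distinct and lie in \<open>H\<close>, which has only \<open>n\<close> elements.\<close>
  have H_eq: "(\<lambda>k. x [^] k) ` {1..n} = H"
    using card_H \<open>n > 0\<close> sub card_image[OF inj] by (intro card_subset_eq card_ge_0_finite) auto
  have ord_iff: "ord (x [^] k) = n \<longleftrightarrow> coprime k n" for k :: nat
  proof -
    have "n div gcd n k = n \<longleftrightarrow> gcd n k = 1"
      using \<open>n > 0\<close> by (simp add: div_eq_dividend_iff)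
    then show ?thesis
      using ord_pow_gen[OF x(1), of k] x(3)
      by (auto simp: coprime_iff_gcd_eq_1 gcd.commute)
  qed
  have "{y \<in> H. ord y = n} = (\<lambda>k. x [^] k) ` {k \<in> {1..n}. ord (x [^] k) = n}"
    unfolding H_eq[symmetric] by blast
  also have "{k \<in> {1..n}. ord (x [^] k) = n} = totatives n"
    unfolding ord_iff by (auto simp: totatives_def)
  finally have "{y \<in> H. ord y = n} = (\<lambda>k. x [^] k) ` totatives n" .
  moreover have "inj_on (\<lambda>k. x [^] k) (totatives n)"
    using inj by (rule inj_on_subset) (auto simp: totatives_def)
  ultimately show ?thesis by (simp add: card_image totient_def)
qed

lemma (in group) card_ord_eq_totient_mult_cyclic_subgroups:
  assumes "finite (carrier G)" "n > 0"
  shows "card {x \<in> carrier G. ord x = n} = totient n * card (cyclic_subgroups G n)"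
proof -
  have sub: "H \<subseteq> carrier G" if "H \<in> cyclic_subgroups G n" for H
    using that by (auto simp: cyclic_subgroups_def dest: subgroup.subset)
  then have fin: "finite (cyclic_subgroups G n)"
    using assms(1) by (auto intro: finite_subset[of _ "Pow (carrier G)"])
  have "{x \<in> carrier G. ord x = n} = (\<Union>H\<in>cyclic_subgroups G n. {y \<in> H. ord y = n})"
    using sub generate_in_cyclic_subgroups by (auto intro: generate.incl)
  also have "card \<dots> = (\<Sum>H\<in>cyclic_subgroups G n. card {y \<in> H. ord y = n})"
  proof (rule card_UN_disjoint[OF fin])
    show "\<forall>H\<in>cyclic_subgroups G n. finite {y \<in> H. ord y = n}"
      using sub assms(1) by (auto intro: finite_subset)
    show "\<forall>H\<in>cyclic_subgroups G n. \<forall>K\<in>cyclic_subgroups G n. H \<noteq> K \<longrightarrow>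
            {y \<in> H. ord y = n} \<inter> {y \<in> K. ord y = n} = {}"
      using cyclic_subgroup_eq_generate[OF _ \<open>n > 0\<close>] by blast
  qed
  also have "\<dots> = totient n * card (cyclic_subgroups G n)"
    using card_generators_cyclic_subgroup[OF _ \<open>n > 0\<close>] by simp
  finally show ?thesis .
qed

text \<open>
  The divisors of \<open>p ^ x\<close> other than \<open>p ^ x\<close> itself are the divisors of \<open>p ^ (x - 1)\<close>.
\<close>
lemma (in group) card_ord_prime_power:
  assumes "finite (carrier G)" "prime p" "x > 0"
  shows "card {g \<in> carrier G. ord g = p ^ x} + card {g \<in> carrier G. g [^] (p ^ (x - 1)) = \<one>}
         = card {g \<in> carrier G. g [^] (p ^ x) = \<one>}"
proof -
  have "d dvd p ^ x \<longleftrightarrow> d = p ^ x \<or> d dvd p ^ (x - 1)" for d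
  proof -
    have "d dvd p ^ x \<longleftrightarrow> (\<exists>j\<le>x. d = p ^ j)"
      using divides_primepow_nat[OF \<open>prime p\<close>] by blast
    also have "\<dots> \<longleftrightarrow> d = p ^ x \<or> (\<exists>j\<le>x - 1. d = p ^ j)"
      using \<open>x > 0\<close> by (metis One_nat_def Suc_pred le_Suc_eq)
    also have "(\<exists>j\<le>x - 1. d = p ^ j) \<longleftrightarrow> d dvd p ^ (x - 1)"
      using divides_primepow_nat[OF \<open>prime p\<close>] by blast
    finally show ?thesis .
  qed
  moreover have "\<not> p ^ x dvd p ^ (x - 1)"
    using assms(2,3) by (simp add: prime_nat_iff power_dvd_imp_le dvd_power_iff_le prime_ge_2_nat)
  ultimately have
    "{g \<in> carrier G. g [^] (p ^ x) = \<one>} =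
       {g \<in> carrier G. ord g = p ^ x} \<union> {g \<in> carrier G. g [^] (p ^ (x - 1)) = \<one>}"
    "{g \<in> carrier G. ord g = p ^ x} \<inter> {g \<in> carrier G. g [^] (p ^ (x - 1)) = \<one>} = {}"
    by (auto simp: pow_eq_id)
  then show ?thesis
    using assms(1) by (simp add: card_Un_disjoint)
qed

section \<open>Elements killed by a given exponent\<close>

lemma pow_product_group:
  assumes "\<And>i. i \<in> I \<Longrightarrow> group (G i)" "f \<in> carrier (product_group I G)"
  shows "f [^]\<^bsub>product_group I G\<^esub> (n::nat) = (\<lambda>i\<in>I. f i [^]\<^bsub>G i\<^esub> n)"
  by (induction n) (auto simp: fun_eq_iff)

lemma card_torsion_product_group:
  assumes "finite I" "\<And>i. i \<in> I \<Longrightarrow> group (G i)"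
  shows "card {f \<in> carrier (product_group I G). f [^]\<^bsub>product_group I G\<^esub> (n::nat) = \<one>\<^bsub>product_group I G\<^esub>}
         = (\<Prod>i\<in>I. card {x \<in> carrier (G i). x [^]\<^bsub>G i\<^esub> n = \<one>\<^bsub>G i\<^esub>})"
proof -
  have "{f \<in> carrier (product_group I G). f [^]\<^bsub>product_group I G\<^esub> n = \<one>\<^bsub>product_group I G\<^esub>}
        = {f \<in> carrier (product_group I G). (\<lambda>i\<in>I. f i [^]\<^bsub>G i\<^esub> n) = (\<lambda>i\<in>I. \<one>\<^bsub>G i\<^esub>)}"
    using pow_product_group[of I G] assms(2) by auto
  also have "\<dots> = (\<Pi>\<^sub>E i\<in>I. {x \<in> carrier (G i). x [^]\<^bsub>G i\<^esub> n = \<one>\<^bsub>G i\<^esub>})"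
    by (auto simp: PiE_iff fun_eq_iff restrict_def split: if_splits intro: extensional_arb)
  finally show ?thesis
    using assms(1) by (simp add: card_PiE)
qed

text \<open>
  With \<open>g = gcd m n\<close>, the solutions of \<open>m * x = 0\<close> in the integers modulo \<open>n\<close> are the multiples
  of \<open>n div g\<close>, and \<open>g\<close> of these lie in \<open>{0..<n}\<close>.
\<close>
lemma card_torsion_integer_mod_group:
  assumes "n > 0"
  shows "card {x \<in> carrier (integer_mod_group n).
           x [^]\<^bsub>integer_mod_group n\<^esub> m = \<one>\<^bsub>integer_mod_group n\<^esub>} = gcd m n"
proof -
  define g q where "g = gcd m n" and "q = int (n div g)"
  have "g > 0" and n: "int n = q * int g"
    using assms by (auto simp: g_def q_def simp flip: of_nat_mult)
  have "q > 0" using assms n \<open>g > 0\<close> by (metis of_nat_0_less_iff zero_less_mult_pos2)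
  have m: "int m = int (m div g) * int g"
    by (simp add: g_def flip: of_nat_mult)
  have "coprime (m div g) (n div g)"
    unfolding g_def using assms by (intro div_gcd_coprime) auto
  then have "coprime q (int (m div g))" by (simp add: q_def coprime_commute)
  then have dvd: "int n dvd int m * x \<longleftrightarrow> q dvd x" for x
  proof -
    have "int m * x = (int (m div g) * x) * int g"
      unfolding m by (simp only: ac_simps)
    then have "int n dvd int m * x \<longleftrightarrow> q dvd int (m div g) * x"
      using \<open>g > 0\<close> unfolding n by (simp only: dvd_mult_cancel_right) simp
    also have "\<dots> \<longleftrightarrow> q dvd x"
      using \<open>coprime q (int (m div g))\<close> by (rule coprime_dvd_mult_right_iff)
    finally show ?thesis .
  qed
  have "{x \<in> carrier (integer_mod_group n).
           x [^]\<^bsub>integer_mod_group n\<^esub> m = \<one>\<^bsub>integer_mod_group n\<^esub>} = {x \<in> {0..<int n}. q dvd x}"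
    using assms dvd by (auto simp: carrier_integer_mod_group mod_eq_0_iff_dvd)
  also have "\<dots> = (\<lambda>y. q * y) ` {0..<int g}"
    using \<open>q > 0\<close> unfolding n by (auto simp: zero_le_mult_iff elim!: dvdE)
  also have "card \<dots> = g"
    using \<open>q > 0\<close> by (subst card_image) (auto simp: inj_on_def)
  finally show ?thesis by (simp add: g_def)
qed

lemma gcd_prime_power_eq_min:
  fixes p :: nat
  shows "gcd (p ^ x) (p ^ y) = p ^ min x y"
  by (cases "x \<le> y") (auto simp: min_def le_imp_power_dvd gcd_nat.absorb1 gcd_nat.absorb2)

lemma card_torsion_abelian_p_group:
  fixes p :: nat
  assumes "p > 0"
  shows "card {g \<in> carrier (abelian_p_group p k a).
           g [^]\<^bsub>abelian_p_group p k a\<^esub> (p ^ x) = \<one>\<^bsub>abelian_p_group p k a\<^esub>}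
         = p ^ (\<Sum>i=1..k. min x (a i))"
  unfolding abelian_p_group_def using assms
  by (subst card_torsion_product_group)
     (simp_all only: finite_atLeastAtMost group_integer_mod_group card_torsion_integer_mod_group
        zero_less_power gcd_prime_power_eq_min power_sum)

section \<open>The number of cyclic subgroups of an abelian p-group\<close>

text \<open>
  The case distinction in the definition of \<open>h_fun\<close> evaluates the minima below: if case \<open>j\<close>
  applies, then the minimum is \<open>a i\<close> for \<open>i \<le> j\<close> and \<open>x\<close> for \<open>i > j\<close>.
\<close>
lemma h_fun_eq_sum_min:
  assumes mono: "mono_on {1..m} a"
  shows "h_fun p m a x = p ^ (\<Sum>i=1..m. min x (a i))"
proof -
  define j where "j = h_case m a x"
  have j: "j < m \<longrightarrow> x \<le> a (Suc j)"
    unfolding j_def h_case_def by (rule LeastI[of _ m]) simp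
  have "j \<le> m"
    unfolding j_def h_case_def by (rule Least_le) simp
  have below: "a i \<le> x" if "i \<in> {1..j}" for i
  proof -
    have "\<not> (i - 1 < m \<longrightarrow> x \<le> a (Suc (i - 1)))"
      using that unfolding j_def h_case_def by (intro not_less_Least) auto
    then show ?thesis using that by auto
  qed
  have above: "x \<le> a i" if "i \<in> {Suc j..m}" for i
  proof -
    have "a (Suc j) \<le> a i"
      using that by (intro mono_onD[OF mono]) auto
    then show ?thesis using j that by auto
  qed
  have "{1..m} = {1..j} \<union> {Suc j..m}" using \<open>j \<le> m\<close> by auto
  then have "(\<Sum>i=1..m. min x (a i)) = (\<Sum>i=1..j. min x (a i)) + (\<Sum>i=Suc j..m. min x (a i))"
    by (simp add: sum.union_disjoint)
  also have "(\<Sum>i=1..j. min x (a i)) = (\<Sum>i=1..j. a i)"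
    using below by (intro sum.cong) (auto simp: min_def intro: antisym)
  also have "(\<Sum>i=Suc j..m. min x (a i)) = (m - j) * x"
    using above by (simp add: min_absorb1)
  finally show ?thesis
    by (simp add: h_fun_def Let_def add.commute flip: j_def)
qed

theorem theorem4p3:
  fixes p k \<alpha> :: nat and a :: "nat \<Rightarrow> nat"
  assumes "prime p"
    and "k \<ge> 1"
    and "1 \<le> a 1" and "mono_on {1..k} a"
    and "1 \<le> \<alpha>" and "\<alpha> \<le> a k"
  shows "real (card (cyclic_subgroups (abelian_p_group p k a) (p ^ \<alpha>))) = g_fun p k a \<alpha>"
proof -
  let ?G = "abelian_p_group p k a"
  let ?h = "h_fun p (k - 1) a"
  have p: "p > 1" using \<open>prime p\<close> by (rule prime_gt_1_nat)
  interpret G: group ?G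
    unfolding abelian_p_group_def by simp
  have fin: "finite (carrier ?G)"
    using p by (auto simp: abelian_p_group_def carrier_integer_mod_group intro!: finite_PiE)
  have mono: "mono_on {1..k - 1} a"
    using \<open>mono_on {1..k} a\<close> by (rule mono_on_subset) auto
  have torsion: "card {g \<in> carrier ?G. g [^]\<^bsub>?G\<^esub> (p ^ x) = \<one>\<^bsub>?G\<^esub>} = p ^ x * ?h x"
    if "x \<le> a k" for x
  proof -
    have "{1..k} = insert k {1..k - 1}" using \<open>k \<ge> 1\<close> by auto
    then have "(\<Sum>i=1..k. min x (a i)) = x + (\<Sum>i=1..k - 1. min x (a i))"
      using \<open>k \<ge> 1\<close> that by simp
    then show ?thesis
      unfolding h_fun_eq_sum_min[OF mono]
      using p by (simp add: card_torsion_abelian_p_group power_add)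
  qed
  have "totient (p ^ \<alpha>) * card (cyclic_subgroups ?G (p ^ \<alpha>)) + p ^ (\<alpha> - 1) * ?h (\<alpha> - 1)
        = p ^ \<alpha> * ?h \<alpha>"
    using G.card_ord_prime_power[OF fin \<open>prime p\<close>, of \<alpha>] assms(5,6) p torsion[of \<alpha>]
      torsion[of "\<alpha> - 1"] G.card_ord_eq_totient_mult_cyclic_subgroups[OF fin, of "p ^ \<alpha>"]
    by simp
  then have "real (totient (p ^ \<alpha>)) * real (card (cyclic_subgroups ?G (p ^ \<alpha>)))
      = real p ^ \<alpha> * real (?h \<alpha>) - real p ^ (\<alpha> - 1) * real (?h (\<alpha> - 1))"
    by (simp add: eq_diff_eq flip: of_nat_mult of_nat_add of_nat_power)
  moreover have "real (totient (p ^ \<alpha>)) = real p ^ \<alpha> - real p ^ (\<alpha> - 1)"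
    using totient_prime_power_Suc[OF \<open>prime p\<close>, of "\<alpha> - 1"] \<open>1 \<le> \<alpha>\<close> p
    by (cases \<alpha>) (simp_all add: of_nat_diff algebra_simps)
  moreover have "real p ^ \<alpha> - real p ^ (\<alpha> - 1) \<noteq> 0"
    using p \<open>1 \<le> \<alpha>\<close> by simp
  ultimately show ?thesis
    by (simp add: g_fun_def field_simps)
qed

end
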